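(* For a finite lattice $L$, the following conditions are equivalent. (i) $L$ is planar; (ii) $L$ has a complementary order relation; (iii) $L$ has order dimension at most $2$; (iv) $L$ has an order embedding into the direct product of two chains.
   Context: "Order" means strict partial order (irreflexive and transitive); $<$ is the order of the lattice and $\prec$ its covering relation. A finite ordered set $(P,<)$ has a complementary order relation $\lambda$ if $\lambda$ is a strict partial order on $P$ such that any two distinct elements of $P$ are comparable by exactly one of $<$ and $\lambda$. Order dimension at most $2$ means that $<$ is the intersection of two total (strict) orders on the same set. The direct product of two chains carries the componentwise order, and an order embedding is a map $\varphi$ with $a\le b$ if and only if $\varphi(a)\le\varphi(b)$. Points of $\mathbb{R}^2$ are written $u=(u_x,u_y)$, and $\overline{pq}$ is the straight line segment from $p$ to $q$. A diagram is a finite ordered set $H$ whose elements are distinct points of $\mathbb{R}^2$ such that for each covering $p\prec q$ in $H$ we have $p_y<q_y$ ($y$-isotone property) and $\overline{pq}\cap H=\{p,q\}$ (noninterference property). A diagram $H$ is planar if any two distinct covering segments $\overline{pq}$, $\overline{p'q'}$ ($p\prec q$, $p'\prec q'$ in $H$) are disjoint or intersect only at their endpoints. A planar lattice diagram is a planar diagram that is a lattice as an ordered set. A finite lattice $L$ is planar if it is isomorphic to some planar lattice diagram. *)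

theory Defs
  imports
    "HOL-Analysis.Line_Segment"
    "HOL-Algebra.Lattice"
    "HOL-Library.Infinite_Typeclass"
begin

definition strict_partial_ord_on :: "'a set \<Rightarrow> ('a \<Rightarrow> 'a \<Rightarrow> bool) \<Rightarrow> bool" where
  "strict_partial_ord_on A r \<longleftrightarrow> irreflp_on A r \<and> transp_on A r"

definition strict_total_ord_on :: "'a set \<Rightarrow> ('a \<Rightarrow> 'a \<Rightarrow> bool) \<Rightarrow> bool" where
  "strict_total_ord_on A r \<longleftrightarrow> strict_partial_ord_on A r \<and> totalp_on A r"

definition covers :: "('a, 'm) gorder_scheme \<Rightarrow> 'a \<Rightarrow> 'a \<Rightarrow> bool" where
  "covers P p q \<longleftrightarrow> p \<in> carrier P \<and> q \<in> carrier P \<and> p \<sqsubset>\<^bsub>P\<^esub> q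
     \<and> \<not> (\<exists>z\<in>carrier P. p \<sqsubset>\<^bsub>P\<^esub> z \<and> z \<sqsubset>\<^bsub>P\<^esub> q)"

text \<open>The order of a diagram is part of the data; it is related to the position of the
  points in the plane only through the two conditions on coverings.\<close>

definition diagram :: "(real \<times> real) gorder \<Rightarrow> bool" where
  "diagram H \<longleftrightarrow> partial_order H \<and> finite (carrier H)
     \<and> (\<forall>p q. covers H p q \<longrightarrow> snd p < snd q)
     \<and> (\<forall>p q. covers H p q \<longrightarrow> closed_segment p q \<inter> carrier H = {p, q})"

definition planar_diagram :: "(real \<times> real) gorder \<Rightarrow> bool" where
  "planar_diagram H \<longleftrightarrow> diagram H
     \<and> (\<forall>p q p' q'. covers H p q \<longrightarrow> covers H p' q' \<longrightarrow> closed_segment p q \<noteq> closed_segment p' q'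
          \<longrightarrow> closed_segment p q \<inter> closed_segment p' q' \<subseteq> {p, q} \<inter> {p', q'})"

definition planar_lattice_diagram :: "(real \<times> real) gorder \<Rightarrow> bool" where
  "planar_lattice_diagram H \<longleftrightarrow> planar_diagram H \<and> lattice H"

definition order_iso :: "('a, 'm) gorder_scheme \<Rightarrow> ('b, 'n) gorder_scheme \<Rightarrow> ('a \<Rightarrow> 'b) \<Rightarrow> bool" where
  "order_iso P Q f \<longleftrightarrow> order_emb P Q f \<and> bij_betw f (carrier P) (carrier Q)"

definition planar :: "('a, 'm) gorder_scheme \<Rightarrow> bool" where
  "planar L \<longleftrightarrow> (\<exists>H f. planar_lattice_diagram H \<and> order_iso L H f)"

definition complementary_order ::
    "('a, 'm) gorder_scheme \<Rightarrow> ('a \<Rightarrow> 'a \<Rightarrow> bool) \<Rightarrow> bool" where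
  "complementary_order P lam \<longleftrightarrow> strict_partial_ord_on (carrier P) lam
     \<and> (\<forall>x\<in>carrier P. \<forall>y\<in>carrier P. x \<noteq> y \<longrightarrow>
          (x \<sqsubset>\<^bsub>P\<^esub> y \<or> y \<sqsubset>\<^bsub>P\<^esub> x) \<noteq> (lam x y \<or> lam y x))"

definition order_dim_le_2 :: "('a, 'm) gorder_scheme \<Rightarrow> bool" where
  "order_dim_le_2 P \<longleftrightarrow>
     (\<exists>r s. strict_total_ord_on (carrier P) r \<and> strict_total_ord_on (carrier P) s
        \<and> (\<forall>x\<in>carrier P. \<forall>y\<in>carrier P. x \<sqsubset>\<^bsub>P\<^esub> y \<longleftrightarrow> r x y \<and> s x y))"

definition prod_order ::
    "('a, 'm) gorder_scheme \<Rightarrow> ('b, 'n) gorder_scheme \<Rightarrow> ('a \<times> 'b) gorder" where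
  "prod_order C D = \<lparr>carrier = carrier C \<times> carrier D, eq = (=),
     le = (\<lambda>u v. fst u \<sqsubseteq>\<^bsub>C\<^esub> fst v \<and> snd u \<sqsubseteq>\<^bsub>D\<^esub> snd v)\<rparr>"

text \<open>\<^const>\<open>order_emb\<close> does not require that the map sends carrier to carrier.

  HOL cannot quantify existentially over the types in which the two chains live, so these types
  are parameters. The chains are arbitrary totally ordered subsets, with arbitrary orders, of
  arbitrary infinite types. Only the finite projections of the image of a finite order matter,
  and any infinite type has room for copies of them, so the choice of types is immaterial.\<close>

definition embeds_into_two_chains ::
    "'c::infinite itself \<Rightarrow> 'd::infinite itself \<Rightarrow> ('a, 'm) gorder_scheme \<Rightarrow> bool" where
  "embeds_into_two_chains _ _ L \<longleftrightarrow>
     (\<exists>(C :: 'c gorder) (D :: 'd gorder) f. total_order C \<and> total_order D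
        \<and> f \<in> carrier L \<rightarrow> carrier (prod_order C D) \<and> order_emb L (prod_order C D) f)"

end

theory Submission
  imports Defs
begin

text \<open>A maximal chain of a planar lattice diagram runs from the bottom to the top element and so
  is drawn as a polygonal path which is the graph of a function of the height. Every element is on
  it, to its left or to its right, and by planarity two such paths can only change sides in a
  common vertex. Hence for incomparable \<open>x\<close> and \<open>y\<close> the side of a chain through \<open>y\<close> on which
  \<open>x\<close> lies does not depend on the chain, and ``left of'' is a complementary order. Transitivity
  reduces to excluding a cycle \<open>x, y, z\<close>, which may be rotated so that \<open>y\<close> has the median height.

  Adding a complementary order or its converse to \<open><\<close> gives two linear extensions whose
  intersection is \<open><\<close>. Conversely, the ranks in the two linear orders are coordinates which, after
  a rotation by 45 degrees, draw \<open>L\<close> in the plane; joins prevent covering segments from crossing.\<close>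

section \<open>Saturated chains\<close>

text \<open>Covering steps from the least to the greatest element leave no room for a further
  element, which is what makes the chain maximal. The list keeps the vertices in the order in which
  the drawn path visits them.\<close>

definition maximal_chain :: "('a, 'm) gorder_scheme \<Rightarrow> 'a list \<Rightarrow> bool" where
  "maximal_chain L xs \<longleftrightarrow> xs \<noteq> [] \<and> successively (covers L) xs
     \<and> least L (hd xs) (carrier L) \<and> greatest L (last xs) (carrier L)"

context partial_order
begin

lemma lless_iff: "x \<sqsubset> y \<longleftrightarrow> x \<sqsubseteq> y \<and> x \<noteq> y"
  by (simp add: lless_def eq_is_equal)

lemma transp_on_lless: "transp_on (carrier L) (\<sqsubset>)"
  by (rule transp_onI) (metis lless_iff le_antisym le_trans)

text \<open>If some \<open>z\<close> lies strictly between \<open>a\<close> and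
  \<open>hd xs\<close>, the chain is extended down to \<open>z\<close> and from there to
  \<open>a\<close>. Both extensions concern smaller half-open intervals: (z, hd xs] misses
  \<open>z\<close>, and (a, z] misses \<open>hd xs\<close>.\<close>

lemma saturated_chain_extend_down:
  assumes "finite (carrier L)"
    and "xs \<noteq> []" "successively (covers L) xs" "set xs \<subseteq> carrier L"
    and "a \<in> carrier L" "a \<sqsubseteq> hd xs"
  shows "\<exists>ys. successively (covers L) (ys @ xs) \<and> hd (ys @ xs) = a \<and> set ys \<subseteq> carrier L"
  using assms(2-)
proof (induction "card {z \<in> carrier L. a \<sqsubset> z \<and> z \<sqsubseteq> hd xs}" arbitrary: a xs rule: less_induct)
  case less
  have hd: "hd xs \<in> carrier L" using less.prems by auto
  consider "a = hd xs" | "covers L a (hd xs)"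
    | z where "z \<in> carrier L" "a \<sqsubset> z" "z \<sqsubset> hd xs"
    using less.prems hd by (auto simp: covers_def lless_iff)
  then show ?case
  proof cases
    case 1
    then show ?thesis using less.prems by (intro exI[of _ "[]"]) auto
  next
    case 2
    then show ?thesis using less.prems
      by (intro exI[of _ "[a]"]) (auto simp: successively_Cons)
  next
    case 3
    have "a \<sqsubset> hd xs"
      using transp_on_lless 3 hd less.prems(4) by (metis transp_onD)
    have "card {w \<in> carrier L. z \<sqsubset> w \<and> w \<sqsubseteq> hd xs} < card {w \<in> carrier L. a \<sqsubset> w \<and> w \<sqsubseteq> hd xs}"
    proof (rule psubset_card_mono)
      have "a \<sqsubset> w" if "w \<in> carrier L" "z \<sqsubset> w" for w
        using transp_onD[OF transp_on_lless less.prems(4) 3(1) that(1) 3(2) that(2)] .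
      moreover have "z \<notin> {w \<in> carrier L. z \<sqsubset> w \<and> w \<sqsubseteq> hd xs}" by (simp add: lless_iff)
      moreover have "z \<in> {w \<in> carrier L. a \<sqsubset> w \<and> w \<sqsubseteq> hd xs}" using 3 by (simp add: lless_iff)
      ultimately show "{w \<in> carrier L. z \<sqsubset> w \<and> w \<sqsubseteq> hd xs} \<subset> {w \<in> carrier L. a \<sqsubset> w \<and> w \<sqsubseteq> hd xs}"
        by blast
    qed (use assms(1) in simp)
    from less.hyps[OF this less.prems(1-3) 3(1)] 3 obtain ys
      where ys: "successively (covers L) (ys @ xs)" "hd (ys @ xs) = z" "set ys \<subseteq> carrier L"
      by (auto simp: lless_iff)
    have "card {w \<in> carrier L. a \<sqsubset> w \<and> w \<sqsubseteq> hd (ys @ xs)} < card {w \<in> carrier L. a \<sqsubset> w \<and> w \<sqsubseteq> hd xs}"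
    proof (rule psubset_card_mono)
      have "hd xs \<notin> {w \<in> carrier L. a \<sqsubset> w \<and> w \<sqsubseteq> z}"
        using 3 hd by (auto simp: lless_iff)
      then show "{w \<in> carrier L. a \<sqsubset> w \<and> w \<sqsubseteq> hd (ys @ xs)} \<subset> {w \<in> carrier L. a \<sqsubset> w \<and> w \<sqsubseteq> hd xs}"
        unfolding ys(2) using 3 hd \<open>a \<sqsubset> hd xs\<close> by (auto simp: lless_iff intro: le_trans)
    qed (use assms(1) in simp)
    from less.hyps[OF this] less.prems ys 3 obtain us
      where "successively (covers L) (us @ ys @ xs)" "hd (us @ ys @ xs) = a" "set us \<subseteq> carrier L"
      by (auto simp: lless_iff)
    then show ?thesis using ys by (intro exI[of _ "us @ ys"]) auto
  qed
qed

lemma sorted_wrt_saturated_chain: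
  assumes "successively (covers L) xs" "set xs \<subseteq> carrier L"
  shows "sorted_wrt (\<sqsubset>) xs"
proof -
  have "successively (\<sqsubset>) xs"
    using assms(1) by (rule successively_mono) (simp add: covers_def)
  moreover have "x \<sqsubset> z" if "x \<in> set xs" "y \<in> set xs" "z \<in> set xs" "x \<sqsubset> y" "y \<sqsubset> z" for x y z
    using transp_on_lless that assms(2) by (meson subsetD transp_onD)
  ultimately show ?thesis
    using successively_iff_sorted_wrt_strong by metis
qed

end

lemma maximal_chain_subset:
  assumes "maximal_chain L xs"
  shows "set xs \<subseteq> carrier L"
proof -
  \<comment> \<open>A one-element list contains no covering pair, so membership of the head is
    assumed here; afterwards it is read off from leastness.\<close>
  have "hd xs \<in> carrier L \<Longrightarrow> successively (covers L) xs \<Longrightarrow> set xs \<subseteq> carrier L"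
    by (induction xs rule: induct_list012) (auto simp: covers_def)
  then show ?thesis
    using assms by (auto simp: maximal_chain_def least_def)
qed

context lattice
begin

lemma finite_least_exists:
  assumes "finite (carrier L)" "carrier L \<noteq> {}"
  shows "\<exists>b. least L b (carrier L)"
proof -
  have "greatest L (\<Sqinter>carrier L) (Lower L (carrier L))"
    using finite_inf_greatest assms by blast
  then show ?thesis
    by (auto simp: greatest_def least_def Lower_def)
qed

lemma finite_greatest_exists:
  assumes "finite (carrier L)" "carrier L \<noteq> {}"
  shows "\<exists>t. greatest L t (carrier L)"
proof -
  have "least L (\<Squnion>carrier L) (Upper L (carrier L))"
    using finite_sup_least assms by blast
  then show ?thesis
    by (auto simp: greatest_def least_def Upper_def)
qed

text \<open>Built from the top down: the list \<open>[t]\<close> is extended to \<open>y\<close>,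
  then to \<open>x\<close>, then to the bottom element.\<close>

lemma maximal_chain_through:
  assumes fin: "finite (carrier L)" and "x \<in> carrier L" "y \<in> carrier L" "x \<sqsubseteq> y"
  shows "\<exists>xs. maximal_chain L xs \<and> x \<in> set xs \<and> y \<in> set xs"
proof -
  obtain b t where b: "least L b (carrier L)" and t: "greatest L t (carrier L)"
    using finite_least_exists finite_greatest_exists assms by blast
  obtain us where us: "successively (covers L) (us @ [t])" "hd (us @ [t]) = y" "set us \<subseteq> carrier L"
    using saturated_chain_extend_down[OF fin, of "[t]" y] assms t by (auto simp: greatest_def)
  obtain vs where vs: "successively (covers L) (vs @ us @ [t])" "hd (vs @ us @ [t]) = x" "set vs \<subseteq> carrier L"
    using saturated_chain_extend_down[OF fin, of "us @ [t]" x] assms t us by (auto simp: greatest_def)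
  obtain ws where ws: "successively (covers L) (ws @ vs @ us @ [t])" "hd (ws @ vs @ us @ [t]) = b"
    using saturated_chain_extend_down[OF fin, of "vs @ us @ [t]" b] assms t b us vs
    by (auto simp: greatest_def least_def)
  have "y \<in> set (us @ [t])" "x \<in> set (vs @ us @ [t])"
    using us(2) vs(2) by (metis hd_in_set append_is_Nil_conv not_Cons_self2)+
  moreover have "maximal_chain L (ws @ vs @ us @ [t])"
    using ws b t by (simp add: maximal_chain_def)
  ultimately show ?thesis by (intro exI[of _ "ws @ vs @ us @ [t]"]) auto
qed

end

section \<open>Polygonal paths as functions of the height\<close>

text \<open>Interpolation by height: the abscissa at height \<open>t\<close> of the line through two
  points of different heights.\<close>

definition seg_x :: "real \<times> real \<Rightarrow> real \<times> real \<Rightarrow> real \<Rightarrow> real" where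
  "seg_x p q t = fst p + (t - snd p) / (snd q - snd p) * (fst q - fst p)"

text \<open>The abscissa at height \<open>t\<close> of an ascending polygonal path. Below the path
  the line of its first edge is continued, above it the value stays that of the last vertex, so that
  continuity can be stated on the whole real line.\<close>

fun path_x :: "(real \<times> real) list \<Rightarrow> real \<Rightarrow> real" where
  "path_x [] t = 0"
| "path_x [p] t = fst p"
| "path_x (p # q # ps) t = (if t \<le> snd q then seg_x p q t else path_x (q # ps) t)"

lemma seg_x_start: "seg_x p q (snd p) = fst p"
  by (simp add: seg_x_def)

lemma seg_x_end: "snd p < snd q \<Longrightarrow> seg_x p q (snd q) = fst q"
  by (simp add: seg_x_def)

lemma seg_x_in_closed_segment:
  assumes "snd p < snd q" "snd p \<le> t" "t \<le> snd q"
  shows "(seg_x p q t, t) \<in> closed_segment p q"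
proof -
  define u where "u = (t - snd p) / (snd q - snd p)"
  have u: "0 \<le> u" "u \<le> 1" "u * (snd q - snd p) = t - snd p"
    using assms by (auto simp: u_def divide_simps)
  then have "(seg_x p q t, t) = (1 - u) *\<^sub>R p + u *\<^sub>R q"
    by (auto simp: prod_eq_iff seg_x_def u_def[symmetric] algebra_simps)
  then show ?thesis
    using u unfolding in_segment by blast
qed

abbreviation ascending :: "(real \<times> real) list \<Rightarrow> bool" where
  "ascending \<equiv> successively (\<lambda>p q. snd p < snd q)"

lemma path_x_hd:
  assumes "ascending ps" "ps \<noteq> []"
  shows "path_x ps (snd (hd ps)) = fst (hd ps)"
  using assms by (cases ps rule: remdups_adj.cases) (auto simp: seg_x_start)

lemma path_x_Cons:
  assumes "ascending (a # ps)" "ps \<noteq> []" "snd (hd ps) \<le> t"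
  shows "path_x (a # ps) t = path_x ps t"
proof (cases "t = snd (hd ps)")
  \<comment> \<open>At the height of the shared vertex the definition still evaluates the first
    edge; both values are the abscissa of that vertex.\<close>
  case True
  then show ?thesis
    using assms path_x_hd[of ps] by (cases ps) (auto simp: seg_x_end)
next
  case False
  then show ?thesis using assms by (cases ps) auto
qed

lemma ascending_hd_le:
  assumes "ascending ps" "p \<in> set ps"
  shows "snd (hd ps) \<le> snd p"
  using assms by (induction ps rule: induct_list012) auto

text \<open>Lets a path be evaluated at a vertex or on an edge by discarding everything before
  it.\<close>

lemma path_x_append:
  assumes "ascending (us @ ps)" "ps \<noteq> []" "snd (hd ps) \<le> t"
  shows "path_x (us @ ps) t = path_x ps t"
  using assms(1)
proof (induction us)
  case (Cons a us)
  then have asc: "ascending (us @ ps)" by (auto simp: successively_Cons)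
  have "snd (hd (us @ ps)) \<le> t"
    using ascending_hd_le[OF asc, of "hd ps"] assms by auto
  then show ?case
    using path_x_Cons[of a "us @ ps" t] Cons asc assms(2) by simp
qed simp

lemma path_x_vertex:
  assumes "ascending ps" "p \<in> set ps"
  shows "path_x ps (snd p) = fst p"
proof -
  obtain us vs where ps: "ps = us @ p # vs" using assms(2) by (meson split_list)
  then show ?thesis
    using path_x_append[of us "p # vs" "snd p"] path_x_hd[of "p # vs"] assms(1)
    by (simp add: successively_append_iff)
qed

lemma path_x_edge:
  assumes "ascending (us @ p # q # vs)" "snd p \<le> t" "t \<le> snd q"
  shows "path_x (us @ p # q # vs) t = seg_x p q t"
  using path_x_append[of us "p # q # vs" t] assms by simp

text \<open>The strict inequality between the end heights excludes a path with a single vertex,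
  which has no edge.\<close>

lemma path_x_edge_exists:
  assumes "ascending ps" "ps \<noteq> []" "snd (hd ps) \<le> t" "t \<le> snd (last ps)" "snd (hd ps) < snd (last ps)"
  shows "\<exists>us p q vs. ps = us @ p # q # vs \<and> snd p \<le> t \<and> t \<le> snd q"
  using assms
proof (induction ps rule: induct_list012)
  case (3 a b ps)
  show ?case
  proof (cases "t \<le> snd b")
    case True
    then show ?thesis using 3 by (intro exI[of _ "[]"]) auto
  next
    case False
    then have "\<exists>us p q vs. b # ps = us @ p # q # vs \<and> snd p \<le> t \<and> t \<le> snd q"
      using 3 by (intro 3) auto
    then show ?thesis by (metis append_Cons)
  qed
qed auto

text \<open>The first edge and the remaining path agree at the height of the second vertex, so the
  two continuous pieces can be glued there.\<close>

lemma continuous_on_path_x: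
  assumes "ascending ps"
  shows "continuous_on UNIV (path_x ps)"
  using assms
proof (induction ps rule: induct_list012)
  case (3 p q ps)
  have "continuous_on ({..snd q} \<union> {snd q..}) (\<lambda>t. if t \<le> snd q then seg_x p q t else path_x (q # ps) t)"
  proof (rule continuous_on_If)
    show "continuous_on {..snd q} (seg_x p q)"
      unfolding seg_x_def using 3 by (intro continuous_intros) auto
    show "continuous_on {snd q..} (path_x (q # ps))"
      using 3 by (auto intro: continuous_on_subset)
    show "seg_x p q t = path_x (q # ps) t" if "t \<in> {snd q..}" "t \<le> snd q" for t
      using that 3 seg_x_end[of p q] path_x_hd[of "q # ps"] by auto
  qed auto
  moreover have "{..snd q} \<union> {snd q..} = UNIV" by auto
  ultimately show ?case by simp
qed (auto simp: continuous_on_def)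

section \<open>The left-right order of a planar lattice diagram\<close>

locale planar_lattice = lattice H for H :: "(real \<times> real) gorder" (structure) +
  assumes planar_diagram: "planar_diagram H"
begin

lemma finite_carrier: "finite (carrier H)"
  and covers_height: "covers H p q \<Longrightarrow> snd p < snd q"
  and noninterference: "covers H p q \<Longrightarrow> closed_segment p q \<inter> carrier H = {p, q}"
  using planar_diagram unfolding planar_diagram_def diagram_def by blast+

lemma planarity:
  "covers H p q \<Longrightarrow> covers H p' q' \<Longrightarrow> closed_segment p q \<noteq> closed_segment p' q'
    \<Longrightarrow> closed_segment p q \<inter> closed_segment p' q' \<subseteq> {p, q} \<inter> {p', q'}"
  using planar_diagram unfolding planar_diagram_def by blast

section \<open>Maximal chains drawn as paths\<close>

abbreviation mc :: "(real \<times> real) list \<Rightarrow> bool" where "mc \<equiv> maximal_chain H"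

lemma mc_ascending: "mc xs \<Longrightarrow> ascending xs"
  unfolding maximal_chain_def by (auto elim: successively_mono dest: covers_height)

lemma mc_exists:
  assumes "x \<in> carrier H"
  obtains xs where "mc xs" "x \<in> set xs"
  using maximal_chain_through[OF finite_carrier assms assms] assms by blast

text \<open>Both the order and the height increase along the list, so each comparison amounts to
  comparing positions.\<close>

lemma mc_less_iff:
  assumes "mc xs" "a \<in> set xs" "b \<in> set xs"
  shows "a \<sqsubset> b \<longleftrightarrow> snd a < snd b"
proof -
  have sub: "set xs \<subseteq> carrier H" using assms maximal_chain_subset by blast
  have 1: "sorted_wrt (\<sqsubset>) xs"
    using sorted_wrt_saturated_chain assms sub by (auto simp: maximal_chain_def)
  have 2: "sorted_wrt (\<lambda>p q. snd p < snd q) xs"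
    using successively_iff_sorted_wrt_strong[of xs "\<lambda>p q. snd p < snd q"]
      mc_ascending[OF assms(1)] by fastforce
  obtain i j where ij: "i < length xs" "j < length xs" "a = xs ! i" "b = xs ! j"
    using assms by (metis in_set_conv_nth)
  have "a \<in> carrier H" "b \<in> carrier H" using assms sub by auto
  consider "i < j" | "i = j" | "j < i" by linarith
  then show ?thesis
  proof cases
    case 1
    then show ?thesis using ij \<open>sorted_wrt (\<sqsubset>) xs\<close> 2 by (auto simp: sorted_wrt_iff_nth_less)
  next
    case 2
    then show ?thesis using ij by (auto simp: lless_iff)
  next
    case 3
    then have "b \<sqsubset> a" "snd b < snd a" using ij 1 2 by (auto simp: sorted_wrt_iff_nth_less)
    then show ?thesis using \<open>a \<in> carrier H\<close> \<open>b \<in> carrier H\<close> by (auto simp: lless_iff)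
  qed
qed

lemma mc_comparable:
  assumes "mc xs" "a \<in> set xs" "b \<in> set xs"
  shows "a \<sqsubseteq> b \<or> b \<sqsubseteq> a"
proof -
  have sub: "set xs \<subseteq> carrier H" using assms maximal_chain_subset by blast
  have "sorted_wrt (\<sqsubset>) xs"
    using sorted_wrt_saturated_chain assms sub by (auto simp: maximal_chain_def)
  moreover obtain i j where ij: "i < length xs" "j < length xs" "a = xs ! i" "b = xs ! j"
    using assms by (metis in_set_conv_nth)
  moreover have "a \<in> carrier H" using assms sub by auto
  ultimately show ?thesis
    by (cases i j rule: linorder_cases) (auto simp: sorted_wrt_iff_nth_less lless_iff)
qed

text \<open>A diagram only prescribes heights for coverings; a maximal chain through both elements
  carries the condition over to all comparable pairs.\<close>

lemma height_mono:
  assumes "a \<in> carrier H" "b \<in> carrier H" "a \<sqsubseteq> b"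
  shows "snd a \<le> snd b"
proof (cases "a = b")
  case False
  obtain xs where "mc xs" "a \<in> set xs" "b \<in> set xs"
    using maximal_chain_through[OF finite_carrier assms] by blast
  then show ?thesis using mc_less_iff[of xs a b] assms False by (simp add: lless_iff)
qed simp

text \<open>The chain runs from the least to the greatest element, so its path passes the height of
  every element of the diagram, including those off the chain.\<close>

lemma mc_height_range:
  assumes "mc xs" "a \<in> carrier H"
  shows "snd (hd xs) \<le> snd a" "snd a \<le> snd (last xs)"
  using assms height_mono by (auto simp: maximal_chain_def least_def greatest_def)

text \<open>Two elements of different heights force the chain to have an edge, and they confine
  \<open>s\<close> to the range of heights of the path.\<close>

lemma mc_edge:
  assumes "mc xs" "a \<in> carrier H" "b \<in> carrier H" "snd a < snd b" "snd a \<le> s" "s \<le> snd b"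
  obtains p q where "p \<in> set xs" "q \<in> set xs" "covers H p q" "snd p \<le> s" "s \<le> snd q"
    "\<And>t. snd p \<le> t \<Longrightarrow> t \<le> snd q \<Longrightarrow> path_x xs t = seg_x p q t"
proof -
  have "xs \<noteq> []" using assms(1) by (simp add: maximal_chain_def)
  moreover have "snd (hd xs) \<le> s" "s \<le> snd (last xs)" "snd (hd xs) < snd (last xs)"
    using mc_height_range[OF assms(1,2)] mc_height_range[OF assms(1,3)] assms(4-6) by linarith+
  ultimately obtain us p q vs where xs: "xs = us @ p # q # vs" "snd p \<le> s" "s \<le> snd q"
    using path_x_edge_exists[OF mc_ascending[OF assms(1)]] by blast
  have "covers H p q"
    using assms(1) xs by (auto simp: maximal_chain_def successively_append_iff)
  then show thesis
    using that[of p q] xs path_x_edge[of us p q vs] mc_ascending[OF assms(1)] by simp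
qed

text \<open>By the intermediate value theorem the two paths meet at a height \<open>s\<close> strictly between
  the given ones, and by planarity either they meet in a common vertex or they share the whole
  edge at height \<open>s\<close>; the lower end of that edge then lies above \<open>a\<close>, where the paths differ.\<close>

lemma mc_crossing:
  assumes mc: "mc xs" "mc ys" and ab: "a \<in> carrier H" "b \<in> carrier H" "snd a < snd b"
    and sign: "(path_x xs (snd a) - path_x ys (snd a)) * (path_x xs (snd b) - path_x ys (snd b)) < 0"
  obtains z where "z \<in> set xs" "z \<in> set ys" "snd a < snd z" "snd z < snd b"
proof -
  define d where "d t = path_x xs t - path_x ys t" for t
  have cont: "continuous_on {snd a..snd b} d"
    unfolding d_def using continuous_on_path_x mc_ascending mc
    by (intro continuous_intros) (auto intro: continuous_on_subset)
  have "\<exists>s. snd a \<le> s \<and> s \<le> snd b \<and> d s = 0"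
    using IVT'[OF _ _ _ cont, of 0] IVT2'[OF _ _ _ cont, of 0] sign ab
    by (auto simp: d_def[symmetric] mult_less_0_iff)
  then obtain s where s: "snd a \<le> s" "s \<le> snd b" "d s = 0" by blast
  have s': "snd a < s" "s < snd b" using s sign by (auto simp: d_def less_le)
  obtain p q where pq: "p \<in> set xs" "q \<in> set xs" "covers H p q" "snd p \<le> s" "s \<le> snd q"
    "\<And>t. snd p \<le> t \<Longrightarrow> t \<le> snd q \<Longrightarrow> path_x xs t = seg_x p q t"
    using mc_edge[OF mc(1) ab s(1,2)] by blast
  obtain p' q' where pq': "p' \<in> set ys" "q' \<in> set ys" "covers H p' q'" "snd p' \<le> s" "s \<le> snd q'"
    "\<And>t. snd p' \<le> t \<Longrightarrow> t \<le> snd q' \<Longrightarrow> path_x ys t = seg_x p' q' t"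
    using mc_edge[OF mc(2) ab s(1,2)] by blast
  define w where "w = (path_x xs s, s)"
  have w: "w \<in> closed_segment p q" "w \<in> closed_segment p' q'"
    using seg_x_in_closed_segment[OF covers_height[OF pq(3)] pq(4,5)]
      seg_x_in_closed_segment[OF covers_height[OF pq'(3)] pq'(4,5)] pq(4-6) pq'(4-6) s(3)
    by (simp_all add: w_def d_def)
  show thesis
  proof (cases "closed_segment p q = closed_segment p' q'")
    case False
    then have "w \<in> {p, q}" "w \<in> {p', q'}" using planarity pq pq' w by blast+
    then show thesis
      using that[of w] pq pq' s' by (auto simp: w_def)
  next
    case True
    \<comment> \<open>A covering segment determines its ends as the elements lying on it, and their
      heights tell which end is the lower one.\<close>
    have pq_eq: "p = p'" "q = q'"
      using noninterference[OF pq(3)] noninterference[OF pq'(3)]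
        covers_height[OF pq(3)] covers_height[OF pq'(3)] True by (auto simp: doubleton_eq_iff)
    have "snd a < snd p"
    proof (rule ccontr)
      assume "\<not> snd a < snd p"
      then have "d (snd a) = 0"
        using pq(5,6) pq'(6) s(1) pq_eq by (simp add: d_def)
      then show False using sign by (simp add: d_def)
    qed
    then show thesis using that[of p] pq pq' s' pq_eq by simp
  qed
qed

text \<open>A form of the crossing lemma that leaves open which of \<open>a\<close> and
  \<open>b\<close> is higher, as happens in its applications.\<close>

lemma mc_crossing_between:
  assumes mc: "mc xs" "mc ys" and ab: "a \<in> carrier H" "b \<in> carrier H"
    and a: "path_x xs (snd a) < path_x ys (snd a)" and b: "path_x ys (snd b) < path_x xs (snd b)"
  obtains z where "z \<in> set xs" "z \<in> set ys"
    "snd a < snd z \<and> snd z < snd b \<or> snd b < snd z \<and> snd z < snd a"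
proof -
  have "(path_x xs (snd a) - path_x ys (snd a)) * (path_x xs (snd b) - path_x ys (snd b)) < 0"
    using a b by (simp add: mult_neg_pos)
  moreover have "snd a \<noteq> snd b" using a b by auto
  ultimately show thesis
    using mc_crossing[OF mc ab] mc_crossing[OF mc ab(2,1)] that
    by (metis linorder_neqE_linordered_idom mult.commute)
qed

text \<open>A point of the path lies on a covering segment, where noninterference admits only the
  vertices. If the ends of the chain do not differ in height there is no edge to use, and
  \<open>x\<close> would coincide with the head.\<close>

lemma off_path:
  assumes "mc xs" "x \<in> carrier H" "x \<notin> set xs"
  shows "path_x xs (snd x) \<noteq> fst x"
proof
  assume eq: "path_x xs (snd x) = fst x"
  note r = mc_height_range[OF assms(1,2)]
  have asc: "ascending xs" using assms mc_ascending by blast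
  have ends: "hd xs \<in> set xs" "last xs \<in> set xs" using assms(1) by (auto simp: maximal_chain_def)
  have sub: "set xs \<subseteq> carrier H" using assms maximal_chain_subset by blast
  show False
  proof (cases "snd (hd xs) < snd (last xs)")
    case True
    obtain p q where pq: "p \<in> set xs" "q \<in> set xs" "covers H p q" "snd p \<le> snd x" "snd x \<le> snd q"
      "\<And>t. snd p \<le> t \<Longrightarrow> t \<le> snd q \<Longrightarrow> path_x xs t = seg_x p q t"
      using mc_edge[OF assms(1) subsetD[OF sub ends(1)] subsetD[OF sub ends(2)] True r] by blast
    then have "x \<in> closed_segment p q"
      using seg_x_in_closed_segment[OF covers_height[OF pq(3)] pq(4,5)] eq
      by (metis prod.collapse)
    then show False using noninterference[OF pq(3)] pq(1,2) assms by auto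
  next
    case False
    then have "snd x = snd (hd xs)" using r by simp
    moreover have "fst x = fst (hd xs)"
      using eq path_x_vertex[OF asc ends(1)] calculation by simp
    ultimately have "x = hd xs" by (simp add: prod_eq_iff)
    then show False using assms ends by simp
  qed
qed

section \<open>The relation "left of" and its transitivity\<close>

definition incomparable :: "real \<times> real \<Rightarrow> real \<times> real \<Rightarrow> bool" where
  "incomparable x y \<longleftrightarrow> x \<in> carrier H \<and> y \<in> carrier H \<and> \<not> x \<sqsubseteq> y \<and> \<not> y \<sqsubseteq> x"

text \<open>One chain through \<open>y\<close> serves as witness; by \<open>side_iff\<close> every
  other chain through \<open>y\<close> gives the same answer.\<close>

definition left_of :: "real \<times> real \<Rightarrow> real \<times> real \<Rightarrow> bool" where
  "left_of x y \<longleftrightarrow> incomparable x y \<and> (\<exists>xs. mc xs \<and> y \<in> set xs \<and> fst x < path_x xs (snd x))"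

text \<open>If both sides disagreed, the two chains would cross in an element between \<open>x\<close> and \<open>y\<close>.
  Since the chains on the two sides of the equivalence are unrelated, the side on which \<open>x\<close> lies
  does not depend on the chain chosen through \<open>y\<close>.\<close>

lemma side_iff:
  assumes xy: "incomparable x y" and xs: "mc xs" "y \<in> set xs" and ys: "mc ys" "x \<in> set ys"
  shows "fst x < path_x xs (snd x) \<longleftrightarrow> path_x ys (snd y) < fst y"
proof -
  have c: "x \<in> carrier H" "y \<in> carrier H" using xy by (auto simp: incomparable_def)
  have "x \<notin> set xs" "y \<notin> set ys"
    using xy xs ys mc_comparable unfolding incomparable_def by blast+
  then have off: "path_x xs (snd x) \<noteq> fst x" "path_x ys (snd y) \<noteq> fst y"
    using off_path c xs ys by blast+
  have vert: "path_x xs (snd y) = fst y" "path_x ys (snd x) = fst x"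
    using path_x_vertex mc_ascending xs ys by auto
  have no_common: False if "z \<in> set xs" "z \<in> set ys"
    "snd x < snd z \<and> snd z < snd y \<or> snd y < snd z \<and> snd z < snd x" for z
  proof -
    have "z \<in> carrier H" using that xs maximal_chain_subset by blast
    moreover have "x \<sqsubset> z \<and> z \<sqsubset> y \<or> y \<sqsubset> z \<and> z \<sqsubset> x"
      using that mc_less_iff xs ys by metis
    ultimately show False
      using xy c unfolding incomparable_def lless_iff by (meson le_trans)
  qed
  show ?thesis
    using mc_crossing_between[OF ys(1) xs(1) c] mc_crossing_between[OF xs(1) ys(1) c] no_common
      off vert by (metis linorder_neqE_linordered_idom order_less_asym)
qed

text \<open>Independence of the chain in usable form: the single witness is replaced by an arbitrary
  chain through either element.\<close>

lemma left_ofD: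
  assumes "left_of x y"
  shows "incomparable x y"
    and "mc xs \<Longrightarrow> y \<in> set xs \<Longrightarrow> fst x < path_x xs (snd x)"
    and "mc ys \<Longrightarrow> x \<in> set ys \<Longrightarrow> path_x ys (snd y) < fst y"
proof -
  show inc: "incomparable x y" using assms by (simp add: left_of_def)
  then obtain ys' where "mc ys'" "x \<in> set ys'"
    using mc_exists unfolding incomparable_def by blast
  then show "mc xs \<Longrightarrow> y \<in> set xs \<Longrightarrow> fst x < path_x xs (snd x)"
    and "mc ys \<Longrightarrow> x \<in> set ys \<Longrightarrow> path_x ys (snd y) < fst y"
    using assms side_iff[OF inc] unfolding left_of_def by metis+
qed

text \<open>The element \<open>y\<close> is off a chain through \<open>x\<close>, hence strictly on
  one side of it. On the left this is \<open>left_of y x\<close> by definition, on the right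
  \<open>side_iff\<close> turns it into \<open>left_of x y\<close>.\<close>

lemma left_of_total:
  assumes "incomparable x y"
  shows "left_of x y \<or> left_of y x"
proof -
  have c: "x \<in> carrier H" "y \<in> carrier H" and inc: "incomparable y x"
    using assms by (auto simp: incomparable_def)
  obtain xs ys where xs: "mc xs" "y \<in> set xs" and ys: "mc ys" "x \<in> set ys"
    using mc_exists c by metis
  have "y \<notin> set ys" using assms ys mc_comparable unfolding incomparable_def by blast
  then have "path_x ys (snd y) \<noteq> fst y" using off_path c ys by blast
  then show ?thesis
    using side_iff[OF assms xs ys] assms inc xs ys unfolding left_of_def by force
qed

text \<open>A chain through both \<open>x\<close> and \<open>z\<close> would start on one side of a
  chain through \<open>y\<close> and reach the other. They would meet in an element between
  \<open>x\<close> and \<open>z\<close>; being comparable to \<open>y\<close>, it would make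
  \<open>y\<close> comparable to \<open>x\<close> or \<open>z\<close>.\<close>

lemma left_of_trans_incomparable:
  assumes xy: "left_of x y" and yz: "left_of y z"
  shows "incomparable x z"
proof (rule ccontr)
  have c: "x \<in> carrier H" "y \<in> carrier H" "z \<in> carrier H"
    using left_ofD(1)[OF xy] left_ofD(1)[OF yz] by (auto simp: incomparable_def)
  assume "\<not> incomparable x z"
  then obtain fs where fs: "mc fs" "x \<in> set fs" "z \<in> set fs"
    using maximal_chain_through[OF finite_carrier] c unfolding incomparable_def by metis
  obtain xs where xs: "mc xs" "y \<in> set xs" using mc_exists c by metis
  have "path_x fs (snd x) < path_x xs (snd x)" "path_x xs (snd z) < path_x fs (snd z)"
    using left_ofD(2)[OF xy xs] left_ofD(3)[OF yz xs] path_x_vertex mc_ascending fs by auto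
  then obtain w where w: "w \<in> set fs" "w \<in> set xs"
    "snd x < snd w \<and> snd w < snd z \<or> snd z < snd w \<and> snd w < snd x"
    using mc_crossing_between[OF fs(1) xs(1) c(1,3)] by blast
  have "w \<in> carrier H" using w xs maximal_chain_subset by blast
  moreover have "x \<sqsubset> w \<and> w \<sqsubset> z \<or> z \<sqsubset> w \<and> w \<sqsubset> x" using w fs mc_less_iff by metis
  moreover have "w \<sqsubseteq> y \<or> y \<sqsubseteq> w" using mc_comparable w xs by blast
  ultimately show False
    using left_ofD(1)[OF xy] left_ofD(1)[OF yz] c unfolding incomparable_def lless_iff
    by (meson le_trans)
qed

text \<open>At the height of \<open>y\<close> the chain through \<open>x\<close> lies to the left of the chain through \<open>z\<close>, and
  at the height of \<open>x\<close> to its right. An element where they cross lies between \<open>x\<close> and \<open>z\<close>, because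
  \<open>y\<close> is the median in height.\<close>

lemma left_of_no_cycle_median:
  assumes xy: "left_of x y" and yz: "left_of y z" and zx: "left_of z x"
    and median: "snd x \<le> snd y \<and> snd y \<le> snd z \<or> snd z \<le> snd y \<and> snd y \<le> snd x"
  shows False
proof -
  have c: "x \<in> carrier H" "y \<in> carrier H" "z \<in> carrier H"
    using left_ofD(1)[OF xy] left_ofD(1)[OF yz] by (auto simp: incomparable_def)
  obtain xs zs where xs: "mc xs" "x \<in> set xs" and zs: "mc zs" "z \<in> set zs"
    using mc_exists c by metis
  have "path_x xs (snd y) < path_x zs (snd y)"
    using left_ofD(3)[OF xy xs] left_ofD(2)[OF yz zs] by simp
  moreover have "path_x zs (snd x) < path_x xs (snd x)"
    using left_ofD(3)[OF zx zs] path_x_vertex[OF mc_ascending xs(2)] xs by simp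
  ultimately obtain w where w: "w \<in> set xs" "w \<in> set zs"
    "snd y < snd w \<and> snd w < snd x \<or> snd x < snd w \<and> snd w < snd y"
    using mc_crossing_between[OF xs(1) zs(1) c(2,1)] by blast
  have "w \<in> carrier H" using w xs maximal_chain_subset by blast
  moreover have "x \<sqsubset> w \<and> w \<sqsubset> z \<or> z \<sqsubset> w \<and> w \<sqsubset> x"
    using w median mc_less_iff[OF xs(1)] mc_less_iff[OF zs(1)] xs zs by auto
  ultimately show False
    using left_ofD(1)[OF zx] c unfolding incomparable_def lless_iff by (meson le_trans)
qed

text \<open>Otherwise \<open>z\<close> is left of \<open>x\<close>, which closes a cycle. One of
  three heights is a median, and the three rotations of the cycle cover the three
  possibilities.\<close>

lemma left_of_trans:
  assumes "left_of x y" "left_of y z"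
  shows "left_of x z"
proof (rule ccontr)
  assume "\<not> left_of x z"
  then have zx: "left_of z x"
    using left_of_total left_of_trans_incomparable assms by blast
  have "(snd x \<le> snd y \<and> snd y \<le> snd z \<or> snd z \<le> snd y \<and> snd y \<le> snd x)
    \<or> (snd y \<le> snd z \<and> snd z \<le> snd x \<or> snd x \<le> snd z \<and> snd z \<le> snd y)
    \<or> (snd z \<le> snd x \<and> snd x \<le> snd y \<or> snd y \<le> snd x \<and> snd x \<le> snd z)"
    by linarith
  then show False
    using left_of_no_cycle_median assms zx by blast
qed

lemma complementary_order_left_of: "complementary_order H left_of"
  unfolding complementary_order_def strict_partial_ord_on_def
proof (intro conjI ballI impI)
  show "irreflp_on (carrier H) left_of"
    by (rule irreflp_onI) (auto simp: left_of_def incomparable_def)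
  show "transp_on (carrier H) left_of"
    by (rule transp_onI) (rule left_of_trans)
  show "(x \<sqsubset> y \<or> y \<sqsubset> x) \<noteq> (left_of x y \<or> left_of y x)"
    if "x \<in> carrier H" "y \<in> carrier H" "x \<noteq> y" for x y
    using that left_of_total[of x y] left_ofD(1)[of x y] left_ofD(1)[of y x]
    unfolding incomparable_def lless_iff by blast
qed

end

section \<open>The equivalences\<close>

lemma order_emb_lless_iff:
  assumes "order_emb L M f" "partial_order L" "partial_order M" "f \<in> carrier L \<rightarrow> carrier M"
    and "x \<in> carrier L" "y \<in> carrier L"
  shows "f x \<sqsubset>\<^bsub>M\<^esub> f y \<longleftrightarrow> x \<sqsubset>\<^bsub>L\<^esub> y"
proof -
  have "f x = f y \<longleftrightarrow> x = y"
    using assms unfolding order_emb_def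
    by (metis partial_order.le_antisym weak_partial_order.le_refl)
  then show ?thesis
    using assms by (simp add: order_emb_def partial_order.lless_iff)
qed

text \<open>The relation \<open>left_of\<close> is pulled back along an isomorphism onto a planar
  lattice diagram.\<close>

lemma planar_imp_complementary_order:
  assumes "planar L" "partial_order L"
  shows "\<exists>lam. complementary_order L lam"
proof -
  obtain H f where H: "planar_lattice_diagram H" and f: "order_emb L H f" "bij_betw f (carrier L) (carrier H)"
    using assms by (auto simp: planar_def order_iso_def)
  interpret lattice H using H by (simp add: planar_lattice_diagram_def)
  interpret planar_lattice H
    by unfold_locales (use H in \<open>simp add: planar_lattice_diagram_def\<close>)
  have fc: "f \<in> carrier L \<rightarrow> carrier H" using f by (auto simp: bij_betw_def)
  have inj: "inj_on f (carrier L)" using f by (simp add: bij_betw_def)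
  have "complementary_order L (\<lambda>x y. left_of (f x) (f y))"
    unfolding complementary_order_def strict_partial_ord_on_def
  proof (intro conjI ballI impI)
    show "irreflp_on (carrier L) (\<lambda>x y. left_of (f x) (f y))"
      by (rule irreflp_onI) (auto simp: left_of_def incomparable_def)
    show "transp_on (carrier L) (\<lambda>x y. left_of (f x) (f y))"
      by (rule transp_onI) (rule left_of_trans)
    show "(x \<sqsubset>\<^bsub>L\<^esub> y \<or> y \<sqsubset>\<^bsub>L\<^esub> x) \<noteq> (left_of (f x) (f y) \<or> left_of (f y) (f x))"
      if "x \<in> carrier L" "y \<in> carrier L" "x \<noteq> y" for x y
    proof -
      have "f x \<in> carrier H" "f y \<in> carrier H" "f x \<noteq> f y"
        using that fc inj by (auto simp: inj_on_def)
      then show ?thesis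
        using complementary_order_left_of order_emb_lless_iff[OF f(1) assms(2) partial_order_axioms fc]
          that unfolding complementary_order_def by metis
    qed
  qed
  then show ?thesis by blast
qed

section \<open>Complementary orders and pairs of linear extensions\<close>

lemma strict_total_ord_onD:
  assumes "strict_total_ord_on A r"
  shows "x \<in> A \<Longrightarrow> \<not> r x x"
    and "r x y \<Longrightarrow> r y z \<Longrightarrow> x \<in> A \<Longrightarrow> y \<in> A \<Longrightarrow> z \<in> A \<Longrightarrow> r x z"
    and "x \<noteq> y \<Longrightarrow> x \<in> A \<Longrightarrow> y \<in> A \<Longrightarrow> r x y \<or> r y x"
  using assms unfolding strict_total_ord_on_def strict_partial_ord_on_def
    irreflp_on_def transp_on_def totalp_on_def by blast+

lemma complementary_order_converse:
  "complementary_order L lam \<Longrightarrow> complementary_order L (\<lambda>x y. lam y x)"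
  unfolding complementary_order_def strict_partial_ord_on_def irreflp_on_def transp_on_def
  by blast

lemma complementary_orderD:
  assumes "complementary_order L lam"
  shows "x \<in> carrier L \<Longrightarrow> \<not> lam x x"
    and "lam x y \<Longrightarrow> lam y z \<Longrightarrow> x \<in> carrier L \<Longrightarrow> y \<in> carrier L \<Longrightarrow> z \<in> carrier L \<Longrightarrow> lam x z"
    and "x \<in> carrier L \<Longrightarrow> y \<in> carrier L \<Longrightarrow> x \<noteq> y
      \<Longrightarrow> (x \<sqsubset>\<^bsub>L\<^esub> y \<or> y \<sqsubset>\<^bsub>L\<^esub> x) \<noteq> (lam x y \<or> lam y x)"
  using assms unfolding complementary_order_def strict_partial_ord_on_def
    irreflp_on_def transp_on_def by blast+

text \<open>If transitivity failed, the steps from \<open>x\<close> to \<open>y\<close> to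
  \<open>z\<close> would close up, either because \<open>x = z\<close> or by a third step back. Of
  three cyclic steps two belong to the same order and compose to the reverse of the remaining one,
  against irreflexivity or exclusiveness.\<close>

lemma complementary_order_linear_extension:
  assumes lam: "complementary_order L lam" and "partial_order L"
  shows "strict_total_ord_on (carrier L) (\<lambda>x y. x \<sqsubset>\<^bsub>L\<^esub> y \<or> lam x y)"
proof -
  interpret partial_order L by fact
  note irr = complementary_orderD(1)[OF lam] and tr = complementary_orderD(2)[OF lam]
    and alt = complementary_orderD(3)[OF lam]
  have ltr: "x \<sqsubset>\<^bsub>L\<^esub> z" if "x \<sqsubset>\<^bsub>L\<^esub> y" "y \<sqsubset>\<^bsub>L\<^esub> z" "x \<in> carrier L" "y \<in> carrier L" "z \<in> carrier L" for x y z
    using transp_onD[OF transp_on_lless] that by blast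
  have lirr: "\<not> x \<sqsubset>\<^bsub>L\<^esub> x" for x by (simp add: lless_iff)
  have excl: "\<not> lam x y" "\<not> lam y x" if "x \<sqsubset>\<^bsub>L\<^esub> y" "x \<in> carrier L" "y \<in> carrier L" for x y
    using alt[of x y] that lirr by blast+
  have trans: "x \<sqsubset>\<^bsub>L\<^esub> z \<or> lam x z"
    if xy: "x \<sqsubset>\<^bsub>L\<^esub> y \<or> lam x y" and yz: "y \<sqsubset>\<^bsub>L\<^esub> z \<or> lam y z"
      and c: "x \<in> carrier L" "y \<in> carrier L" "z \<in> carrier L" for x y z
  proof (rule ccontr)
    assume "\<not> (x \<sqsubset>\<^bsub>L\<^esub> z \<or> lam x z)"
    then have "x = z \<or> z \<sqsubset>\<^bsub>L\<^esub> x \<or> lam z x" using alt[of x z] c by blast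
    then show False
      using xy yz c excl lirr irr ltr[of x y z] ltr[of z x y] ltr[of y z x] tr[of x y z] tr[of z x y] tr[of y z x]
        \<open>\<not> (x \<sqsubset>\<^bsub>L\<^esub> z \<or> lam x z)\<close> by blast
  qed
  show ?thesis
    unfolding strict_total_ord_on_def strict_partial_ord_on_def
  proof (intro conjI irreflp_onI transp_onI totalp_onI)
    show "\<not> (x \<sqsubset>\<^bsub>L\<^esub> x \<or> lam x x)" if "x \<in> carrier L" for x
      using that irr lirr by blast
    show "(x \<sqsubset>\<^bsub>L\<^esub> y \<or> lam x y) \<or> (y \<sqsubset>\<^bsub>L\<^esub> x \<or> lam y x)"
      if "x \<in> carrier L" "y \<in> carrier L" "x \<noteq> y" for x y
      using that alt by blast
  qed (rule trans)
qed

lemma complementary_order_imp_dim: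
  assumes lam: "complementary_order L lam" and po: "partial_order L"
  shows "order_dim_le_2 L"
proof -
  let ?r = "\<lambda>x y. x \<sqsubset>\<^bsub>L\<^esub> y \<or> lam x y" and ?s = "\<lambda>x y. x \<sqsubset>\<^bsub>L\<^esub> y \<or> lam y x"
  have "strict_total_ord_on (carrier L) ?r" "strict_total_ord_on (carrier L) ?s"
    using complementary_order_linear_extension[OF lam po]
      complementary_order_linear_extension[OF complementary_order_converse[OF lam] po] by blast+
  moreover have "x \<sqsubset>\<^bsub>L\<^esub> y \<longleftrightarrow> ?r x y \<and> ?s x y" if "x \<in> carrier L" "y \<in> carrier L" for x y
    using that complementary_orderD(1,2)[OF lam] by blast
  ultimately show ?thesis unfolding order_dim_le_2_def by blast
qed

text \<open>Two total orders agree or disagree on each pair of distinct elements. The pairs on which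
  they agree are the comparable ones; the others are oriented by \<open>r\<close>.\<close>

lemma dim_imp_complementary_order:
  assumes "order_dim_le_2 L" "partial_order L"
  shows "\<exists>lam. complementary_order L lam"
proof -
  obtain r s where r: "strict_total_ord_on (carrier L) r" and s: "strict_total_ord_on (carrier L) s"
    and rs: "\<And>x y. x \<in> carrier L \<Longrightarrow> y \<in> carrier L \<Longrightarrow> x \<sqsubset>\<^bsub>L\<^esub> y \<longleftrightarrow> r x y \<and> s x y"
    using assms by (auto simp: order_dim_le_2_def)
  have "complementary_order L (\<lambda>x y. r x y \<and> s y x)"
    using r s unfolding complementary_order_def strict_total_ord_on_def strict_partial_ord_on_def
      irreflp_on_def transp_on_def totalp_on_def using rs by (intro conjI) metis+
  then show ?thesis by blast
qed

section \<open>Embeddings into products of two chains\<close>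

text \<open>A finite set injects into any infinite type, and the order is transported to its
  image.\<close>

lemma strict_total_ord_on_embeds_chain:
  assumes A: "finite A" and r: "strict_total_ord_on A r"
  obtains C :: "'c::infinite gorder" and f where "total_order C" "f \<in> A \<rightarrow> carrier C"
    "\<And>x y. x \<in> A \<Longrightarrow> y \<in> A \<Longrightarrow> f x \<sqsubseteq>\<^bsub>C\<^esub> f y \<longleftrightarrow> x = y \<or> r x y"
proof -
  obtain f :: "'a \<Rightarrow> 'c" where f: "inj_on f A" using arb_inj_on_finite_infinite[OF A] by blast
  define g where "g = inv_into A f"
  define C :: "'c gorder" where "C = \<lparr>carrier = f ` A, eq = (=), le = \<lambda>u v. u = v \<or> r (g u) (g v)\<rparr>"
  have g: "g (f x) = x" if "x \<in> A" for x using f that by (simp add: g_def)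
  note irr = strict_total_ord_onD(1)[OF r] and tr = strict_total_ord_onD(2)[OF r]
    and tot = strict_total_ord_onD(3)[OF r]
  have "total_order C"
  proof unfold_locales
    fix x y assume "x \<in> carrier C" "y \<in> carrier C" and le: "x \<sqsubseteq>\<^bsub>C\<^esub> y" "y \<sqsubseteq>\<^bsub>C\<^esub> x"
    then obtain a b where ab: "a \<in> A" "b \<in> A" "x = f a" "y = f b"
      by (auto simp: C_def)
    have "\<not> (r a b \<and> r b a)" using irr tr ab by blast
    then show "x .=\<^bsub>C\<^esub> y" using le ab by (auto simp: C_def g)
  next
    fix x y assume "x \<in> carrier C" "y \<in> carrier C"
    then obtain a b where ab: "a \<in> A" "b \<in> A" "x = f a" "y = f b"
      by (auto simp: C_def)
    then show "x \<sqsubseteq>\<^bsub>C\<^esub> y \<or> y \<sqsubseteq>\<^bsub>C\<^esub> x"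
      using tot[of a b] by (auto simp: C_def g)
  qed (use tr g in \<open>auto simp: C_def\<close>)
  moreover have "f \<in> A \<rightarrow> carrier C" by (auto simp: C_def)
  moreover have "f x \<sqsubseteq>\<^bsub>C\<^esub> f y \<longleftrightarrow> x = y \<or> r x y" if "x \<in> A" "y \<in> A" for x y
    using that f by (auto simp: C_def g inj_on_eq_iff)
  ultimately show thesis by (rule that)
qed

text \<open>Needed because \<open>order_emb\<close> demands a weak partial order as its
  target.\<close>

lemma weak_partial_order_prod_order:
  assumes "partial_order C" "partial_order D"
  shows "weak_partial_order (prod_order C D)"
proof -
  interpret C: partial_order C by fact
  interpret D: partial_order D by fact
  show ?thesis
    by unfold_locales
      (auto simp: prod_order_def intro: C.le_antisym D.le_antisym C.le_trans D.le_trans)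
qed

lemma dim_imp_embeds:
  assumes "order_dim_le_2 L" "partial_order L" "finite (carrier L)"
  shows "embeds_into_two_chains TYPE('c::infinite) TYPE('d::infinite) L"
proof -
  interpret partial_order L by fact
  obtain r s where r: "strict_total_ord_on (carrier L) r" and s: "strict_total_ord_on (carrier L) s"
    and rs: "\<And>x y. x \<in> carrier L \<Longrightarrow> y \<in> carrier L \<Longrightarrow> x \<sqsubset>\<^bsub>L\<^esub> y \<longleftrightarrow> r x y \<and> s x y"
    using assms by (auto simp: order_dim_le_2_def)
  obtain C :: "'c gorder" and f where C: "total_order C" "f \<in> carrier L \<rightarrow> carrier C"
    "\<And>x y. x \<in> carrier L \<Longrightarrow> y \<in> carrier L \<Longrightarrow> f x \<sqsubseteq>\<^bsub>C\<^esub> f y \<longleftrightarrow> x = y \<or> r x y"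
    using strict_total_ord_on_embeds_chain[OF assms(3) r] by metis
  obtain D :: "'d gorder" and g where D: "total_order D" "g \<in> carrier L \<rightarrow> carrier D"
    "\<And>x y. x \<in> carrier L \<Longrightarrow> y \<in> carrier L \<Longrightarrow> g x \<sqsubseteq>\<^bsub>D\<^esub> g y \<longleftrightarrow> x = y \<or> s x y"
    using strict_total_ord_on_embeds_chain[OF assms(3) s] by metis
  have "weak_partial_order (prod_order C D)"
    using C D by (intro weak_partial_order_prod_order) (auto simp: total_order_def)
  moreover have "(f x \<sqsubseteq>\<^bsub>C\<^esub> f y \<and> g x \<sqsubseteq>\<^bsub>D\<^esub> g y) \<longleftrightarrow> x \<sqsubseteq>\<^bsub>L\<^esub> y" if "x \<in> carrier L" "y \<in> carrier L" for x y
    using C(3)[OF that] D(3)[OF that] rs[OF that] that by (auto simp: lless_iff)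
  ultimately have "order_emb L (prod_order C D) (\<lambda>x. (f x, g x))"
    by (simp add: order_emb_def prod_order_def weak_partial_order_axioms)
  moreover have "(\<lambda>x. (f x, g x)) \<in> carrier L \<rightarrow> carrier (prod_order C D)"
    using C(2) D(2) by (auto simp: prod_order_def)
  ultimately show ?thesis
    using C(1) D(1) unfolding embeds_into_two_chains_def by blast
qed

text \<open>Distinct elements may share a coordinate, so one chain alone need not induce a total
  order. The other coordinate breaks ties, and injectivity of the pair leaves none.\<close>

lemma lex_strict_total_ord_on:
  assumes C: "total_order C" and D: "total_order D"
    and c: "c \<in> A \<rightarrow> carrier C" and d: "d \<in> A \<rightarrow> carrier D"
    and inj: "inj_on (\<lambda>x. (c x, d x)) A"
  shows "strict_total_ord_on A (\<lambda>x y. c x \<sqsubset>\<^bsub>C\<^esub> c y \<or> c x = c y \<and> d x \<sqsubset>\<^bsub>D\<^esub> d y)"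
proof -
  interpret C: total_order C by fact
  interpret D: total_order D by fact
  have tr: "c x \<sqsubset>\<^bsub>C\<^esub> c z" if "c x \<sqsubset>\<^bsub>C\<^esub> c y" "c y \<sqsubset>\<^bsub>C\<^esub> c z" "x \<in> A" "y \<in> A" "z \<in> A" for x y z
    using that transp_onD[OF C.transp_on_lless, of "c x" "c y" "c z"] c by auto
  have tr': "d x \<sqsubset>\<^bsub>D\<^esub> d z" if "d x \<sqsubset>\<^bsub>D\<^esub> d y" "d y \<sqsubset>\<^bsub>D\<^esub> d z" "x \<in> A" "y \<in> A" "z \<in> A" for x y z
    using that transp_onD[OF D.transp_on_lless, of "d x" "d y" "d z"] d by auto
  have tot: "c x \<sqsubset>\<^bsub>C\<^esub> c y \<or> c x = c y \<or> c y \<sqsubset>\<^bsub>C\<^esub> c x" if "x \<in> A" "y \<in> A" for x y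
    using that c C.total_order_total[of "c x" "c y"] by (auto simp: C.lless_iff)
  have tot': "d x \<sqsubset>\<^bsub>D\<^esub> d y \<or> d x = d y \<or> d y \<sqsubset>\<^bsub>D\<^esub> d x" if "x \<in> A" "y \<in> A" for x y
    using that d D.total_order_total[of "d x" "d y"] by (auto simp: D.lless_iff)
  show ?thesis
    unfolding strict_total_ord_on_def strict_partial_ord_on_def
  proof (intro conjI irreflp_onI transp_onI totalp_onI)
    fix x y assume "x \<in> A" "y \<in> A" "x \<noteq> y"
    then show "(c x \<sqsubset>\<^bsub>C\<^esub> c y \<or> c x = c y \<and> d x \<sqsubset>\<^bsub>D\<^esub> d y) \<or> (c y \<sqsubset>\<^bsub>C\<^esub> c x \<or> c y = c x \<and> d y \<sqsubset>\<^bsub>D\<^esub> d x)"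
      using tot tot' inj by (metis (no_types, lifting) inj_onD)
  qed (metis C.lless_iff D.lless_iff, metis tr tr')
qed

text \<open>The two lexicographic orders are led by different coordinates. Both put \<open>x\<close>
  before \<open>y\<close> exactly when neither coordinate decreases and the two pairs
  differ.\<close>

lemma embeds_imp_dim:
  assumes "embeds_into_two_chains TYPE('c::infinite) TYPE('d::infinite) L" "partial_order L"
  shows "order_dim_le_2 L"
proof -
  interpret partial_order L by fact
  obtain C :: "'c gorder" and D :: "'d gorder" and f where C: "total_order C" and D: "total_order D"
    and f: "f \<in> carrier L \<rightarrow> carrier (prod_order C D)" "order_emb L (prod_order C D) f"
    using assms(1) unfolding embeds_into_two_chains_def by blast
  interpret C: total_order C by fact
  interpret D: total_order D by fact
  define c d where "c = fst \<circ> f" and "d = snd \<circ> f"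
  have c: "c \<in> carrier L \<rightarrow> carrier C" and d: "d \<in> carrier L \<rightarrow> carrier D"
    using f(1) by (auto simp: c_def d_def prod_order_def Pi_iff mem_Times_iff)
  have le: "c x \<sqsubseteq>\<^bsub>C\<^esub> c y \<and> d x \<sqsubseteq>\<^bsub>D\<^esub> d y \<longleftrightarrow> x \<sqsubseteq>\<^bsub>L\<^esub> y" if "x \<in> carrier L" "y \<in> carrier L" for x y
    using f(2) that by (auto simp: order_emb_def prod_order_def c_def d_def)
  have eq: "x = y" if "c x = c y" "d x = d y" "x \<in> carrier L" "y \<in> carrier L" for x y
    using le that by (metis le_antisym le_refl)
  let ?r = "\<lambda>x y. c x \<sqsubset>\<^bsub>C\<^esub> c y \<or> c x = c y \<and> d x \<sqsubset>\<^bsub>D\<^esub> d y"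
  let ?s = "\<lambda>x y. d x \<sqsubset>\<^bsub>D\<^esub> d y \<or> d x = d y \<and> c x \<sqsubset>\<^bsub>C\<^esub> c y"
  have "strict_total_ord_on (carrier L) ?r"
    by (rule lex_strict_total_ord_on[OF C D c d]) (auto intro: inj_onI eq)
  moreover have "strict_total_ord_on (carrier L) ?s"
    by (rule lex_strict_total_ord_on[OF D C d c]) (auto intro: inj_onI eq)
  moreover have "x \<sqsubset>\<^bsub>L\<^esub> y \<longleftrightarrow> ?r x y \<and> ?s x y" if "x \<in> carrier L" "y \<in> carrier L" for x y
  proof -
    have "c x \<in> carrier C" "c y \<in> carrier C" "d x \<in> carrier D" "d y \<in> carrier D"
      using that c d by auto
    then show ?thesis
      using le[OF that] eq[OF _ _ that] by (auto simp: lless_iff C.lless_iff D.lless_iff)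
  qed
  ultimately show ?thesis unfolding order_dim_le_2_def by blast
qed

section \<open>Drawing a lattice of dimension at most two\<close>

text \<open>Up to a rotation by 45 degrees this is the componentwise order of the plane.\<close>

definition cone_le :: "real \<times> real \<Rightarrow> real \<times> real \<Rightarrow> bool" where
  "cone_le u v \<longleftrightarrow> \<bar>fst v - fst u\<bar> \<le> snd v - snd u"

definition cone_order :: "(real \<times> real) set \<Rightarrow> (real \<times> real) gorder" where
  "cone_order S = \<lparr>carrier = S, eq = (=), le = cone_le\<rparr>"

lemma cone_le_refl: "cone_le u u"
  and cone_le_antisym: "cone_le u v \<Longrightarrow> cone_le v u \<Longrightarrow> u = v"
  and cone_le_trans: "cone_le u v \<Longrightarrow> cone_le v w \<Longrightarrow> cone_le u w"
  by (auto simp: cone_le_def prod_eq_iff)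

lemma partial_order_cone_order: "partial_order (cone_order S)"
  by unfold_locales
    (auto simp: cone_order_def cone_le_refl simp del: split_paired_All intro: cone_le_trans,
      (metis cone_le_antisym prod.inject)+)

text \<open>The differences from \<open>p\<close> to \<open>w\<close> and from \<open>w\<close> to
  \<open>q\<close> are nonnegative multiples of the one from \<open>p\<close> to \<open>q\<close>,
  and the defining inequality survives such scaling.\<close>

lemma closed_segment_cone_le:
  assumes "cone_le p q" "w \<in> closed_segment p q"
  shows "cone_le p w" "cone_le w q"
proof -
  obtain u where u: "0 \<le> u" "u \<le> 1" and w: "w = (1 - u) *\<^sub>R p + u *\<^sub>R q"
    using assms(2) unfolding in_segment by blast
  have "fst w - fst p = u * (fst q - fst p)" "snd w - snd p = u * (snd q - snd p)"
    "fst q - fst w = (1 - u) * (fst q - fst p)" "snd q - snd w = (1 - u) * (snd q - snd p)"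
    by (simp_all add: w algebra_simps)
  then show "cone_le p w" "cone_le w q"
    using u assms(1) by (simp_all add: cone_le_def abs_mult mult_left_mono)
qed

text \<open>Both segments follow the ray from \<open>e\<close> through \<open>w\<close>, so the
  shorter one ends on the longer one. The longer one is that in which \<open>w\<close> has the
  smaller parameter.\<close>

lemma segments_share_endpoint:
  fixes e p q w :: "'a::real_vector"
  assumes "w \<in> closed_segment e p" "w \<in> closed_segment e q" "w \<noteq> e"
  shows "p \<in> closed_segment e q \<or> q \<in> closed_segment e p"
proof -
  have *: "q \<in> closed_segment e p"
    if u: "w = (1 - u) *\<^sub>R e + u *\<^sub>R p" and v: "w = (1 - v) *\<^sub>R e + v *\<^sub>R q"
      and "0 \<le> u" "u \<le> v" for u v p q
  proof -
    have "v \<noteq> 0" using v assms(3) by auto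
    then have "v > 0" using that by simp
    have "v *\<^sub>R (q - e) = u *\<^sub>R (p - e)" using u v by (simp add: algebra_simps)
    then have "(1 / v) *\<^sub>R v *\<^sub>R (q - e) = (1 / v) *\<^sub>R u *\<^sub>R (p - e)" by simp
    then have "q - e = (u / v) *\<^sub>R (p - e)" using \<open>v > 0\<close> by simp
    then have "q = (1 - u / v) *\<^sub>R e + (u / v) *\<^sub>R p" by (simp add: algebra_simps)
    moreover have "0 \<le> u / v" "u / v \<le> 1" using that \<open>v > 0\<close> by auto
    ultimately show ?thesis unfolding in_segment by blast
  qed
  obtain u v where "w = (1 - u) *\<^sub>R e + u *\<^sub>R p" "0 \<le> u" "w = (1 - v) *\<^sub>R e + v *\<^sub>R q" "0 \<le> v"
    using assms(1,2) unfolding in_segment by blast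
  then show ?thesis using *[of u p v q] *[of v q u p] by (cases "u \<le> v") auto
qed

text \<open>If two covering segments meet in \<open>w\<close>, both lower ends are below \<open>w\<close> and both upper ends
  above it, so the join of the lower ends is an end of each of the segments.\<close>

lemma planar_lattice_diagram_cone_order:
  assumes "finite S" "lattice (cone_order S)"
  shows "planar_lattice_diagram (cone_order S)"
proof -
  let ?H = "cone_order S"
  interpret lattice ?H by fact
  have [simp]: "carrier ?H = S" "le ?H = cone_le" by (simp_all add: cone_order_def)
  have cov: "p \<in> S" "q \<in> S" "cone_le p q" "p \<noteq> q" if "covers ?H p q" for p q
    using that by (auto simp: covers_def lless_iff)
  have between: "z = p \<or> z = q" if "covers ?H p q" "z \<in> S" "cone_le p z" "cone_le z q" for p q z
    using that by (auto simp: covers_def lless_iff)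
  have height: "snd p < snd q" if "covers ?H p q" for p q
    using cov[OF that] by (auto simp: cone_le_def prod_eq_iff)
  have seg: "closed_segment p q \<inter> S = {p, q}" if "covers ?H p q" for p q
    using cov[OF that] between[OF that] closed_segment_cone_le[OF cov(3)[OF that]] by blast
  have "closed_segment p q \<inter> closed_segment p' q' \<subseteq> {p, q} \<inter> {p', q'}"
    if c: "covers ?H p q" and c': "covers ?H p' q'" and ne: "closed_segment p q \<noteq> closed_segment p' q'"
    for p q p' q'
  proof
    fix w assume "w \<in> closed_segment p q \<inter> closed_segment p' q'"
    then have w: "w \<in> closed_segment p q" "w \<in> closed_segment p' q'" by auto
    note pq = cov[OF c] and pq' = cov[OF c']
    have le: "cone_le p w" "cone_le w q" "cone_le p' w" "cone_le w q'"
      using closed_segment_cone_le pq pq' w by blast+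
    obtain s where s: "least ?H s (Upper ?H {p, p'})"
      using sup_of_two_exists[of p p'] pq pq' by fastforce
    have "Upper ?H {p, p'} = {u \<in> S. cone_le p u \<and> cone_le p' u}"
      using pq pq' by (auto simp: Upper_def simp del: split_paired_All)
    then have "s \<in> S" "cone_le p s" "cone_le p' s" "cone_le s q" "cone_le s q'"
      using s pq pq' cone_le_trans[OF le(1,4)] cone_le_trans[OF le(3,2)]
      by (auto simp: least_def simp del: split_paired_All)
    then have "s = p \<or> s = q" "s = p' \<or> s = q'" using between[OF c] between[OF c'] by blast+
    then consider "p = p'" | "p = q'" | "q = p'" | "q = q'" by blast
    then show "w \<in> {p, q} \<inter> {p', q'}"
    proof cases
      case 1
      \<comment> \<open>With a common lower end, a further common point would put one upper end on
        the other segment. By noninterference it is an end there too, so the segments would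
        coincide.\<close>
      have "w = p"
      proof (rule ccontr)
        assume "w \<noteq> p"
        then have "q \<in> closed_segment p' q' \<or> q' \<in> closed_segment p q"
          using segments_share_endpoint[of w p q q'] w 1 by simp
        then have "q \<in> {p', q'} \<or> q' \<in> {p, q}"
          using seg[OF c] seg[OF c'] pq(2) pq'(2) by blast
        then have "q = q'" using pq(4) pq'(4) 1 by auto
        then show False using ne 1 by simp
      qed
      then show ?thesis using 1 by simp
    next
      case 2
      \<comment> \<open>Here one segment starts where the other stops, so \<open>w\<close> is both
        above and below that point.\<close>
      then have "w = p" using le cone_le_antisym by blast
      then show ?thesis using 2 by simp
    next
      case 3
      then have "w = q" using le cone_le_antisym by blast
      then show ?thesis using 3 by simp
    next
      case 4
      have "w = q"
      proof (rule ccontr)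
        assume "w \<noteq> q"
        then have "p \<in> closed_segment p' q' \<or> p' \<in> closed_segment p q"
          using segments_share_endpoint[of w q p p'] w 4 by (simp add: closed_segment_commute)
        then have "p \<in> {p', q'} \<or> p' \<in> {p, q}"
          using seg[OF c] seg[OF c'] pq(1) pq'(1) by blast
        then have "p = p'" using pq(4) pq'(4) 4 by auto
        then show False using ne 4 by simp
      qed
      then show ?thesis using 4 by simp
    qed
  qed
  then have "planar_diagram ?H"
    unfolding planar_diagram_def diagram_def
    using partial_order_cone_order assms(1) height seg by simp
  then show ?thesis using assms(2) by (simp add: planar_lattice_diagram_def)
qed

lemma lattice_order_iso:
  assumes "lattice L" "partial_order M" "order_iso L M f"
  shows "lattice M"
proof -
  interpret L: lattice L by fact
  interpret M: partial_order M by fact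
  have M: "carrier M = f ` carrier L"
    and le: "\<And>x y. x \<in> carrier L \<Longrightarrow> y \<in> carrier L \<Longrightarrow> f x \<sqsubseteq>\<^bsub>M\<^esub> f y \<longleftrightarrow> x \<sqsubseteq>\<^bsub>L\<^esub> y"
    using assms(3) by (auto simp: order_iso_def order_emb_def bij_betw_def)
  show ?thesis
  proof unfold_locales
    fix x y assume "x \<in> carrier M" "y \<in> carrier M"
    then obtain a b where ab: "a \<in> carrier L" "b \<in> carrier L" "x = f a" "y = f b"
      using M by auto
    obtain s where "least L s (Upper L {a, b})" using L.sup_of_two_exists ab by blast
    then have "least M (f s) (Upper M {x, y})"
      using ab by (auto simp: least_def Upper_def M le)
    then show "\<exists>s. least M s (Upper M {x, y})" by blast
    obtain i where "greatest L i (Lower L {a, b})" using L.inf_of_two_exists ab by blast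
    then have "greatest M (f i) (Lower M {x, y})"
      using ab by (auto simp: greatest_def Lower_def M le)
    then show "\<exists>i. greatest M i (Lower M {x, y})" by blast
  qed
qed

text \<open>The rank is the number of predecessors. It increases strictly along the order, and
  totality gives the converse.\<close>

lemma strict_total_ord_on_rank:
  assumes A: "finite A" and r: "strict_total_ord_on A r"
  obtains a :: "'a \<Rightarrow> real" where "\<And>x y. x \<in> A \<Longrightarrow> y \<in> A \<Longrightarrow> a x \<le> a y \<longleftrightarrow> x = y \<or> r x y"
proof -
  define a where "a x = real (card {z \<in> A. r z x})" for x
  note irr = strict_total_ord_onD(1)[OF r] and tr = strict_total_ord_onD(2)[OF r]
    and tot = strict_total_ord_onD(3)[OF r]
  have less: "a x < a y" if "r x y" "x \<in> A" "y \<in> A" for x y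
  proof -
    have "{z \<in> A. r z x} \<subset> {z \<in> A. r z y}" using that tr irr by blast
    then show ?thesis using A by (simp add: a_def psubset_card_mono)
  qed
  have "a x \<le> a y \<longleftrightarrow> x = y \<or> r x y" if "x \<in> A" "y \<in> A" for x y
    using that less tot by (metis less_le_not_le order_refl)
  then show thesis using that by blast
qed

lemma dim_imp_planar:
  assumes "order_dim_le_2 L" "lattice L" "finite (carrier L)"
  shows "planar L"
proof -
  interpret lattice L by fact
  obtain r s where r: "strict_total_ord_on (carrier L) r" and s: "strict_total_ord_on (carrier L) s"
    and rs: "\<And>x y. x \<in> carrier L \<Longrightarrow> y \<in> carrier L \<Longrightarrow> x \<sqsubset>\<^bsub>L\<^esub> y \<longleftrightarrow> r x y \<and> s x y"
    using assms by (auto simp: order_dim_le_2_def)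
  obtain a :: "'a \<Rightarrow> real"
    where a: "\<And>x y. x \<in> carrier L \<Longrightarrow> y \<in> carrier L \<Longrightarrow> a x \<le> a y \<longleftrightarrow> x = y \<or> r x y"
    using strict_total_ord_on_rank[OF assms(3) r] by metis
  obtain b :: "'a \<Rightarrow> real"
    where b: "\<And>x y. x \<in> carrier L \<Longrightarrow> y \<in> carrier L \<Longrightarrow> b x \<le> b y \<longleftrightarrow> x = y \<or> s x y"
    using strict_total_ord_on_rank[OF assms(3) s] by metis
  \<comment> \<open>The pair of ranks, rotated by 45 degrees and stretched: the absolute difference
    of two increments is at most their sum exactly when both are nonnegative.\<close>
  define f where "f x = (a x - b x, a x + b x)" for x
  let ?H = "cone_order (f ` carrier L)"
  have le: "cone_le (f x) (f y) \<longleftrightarrow> x \<sqsubseteq>\<^bsub>L\<^esub> y" if "x \<in> carrier L" "y \<in> carrier L" for x y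
  proof -
    have "cone_le (f x) (f y) \<longleftrightarrow> a x \<le> a y \<and> b x \<le> b y"
      by (auto simp: cone_le_def f_def)
    then show ?thesis using a[OF that] b[OF that] rs[OF that] that by (auto simp: lless_iff)
  qed
  have "inj_on f (carrier L)"
    by (rule inj_onI) (metis le le_antisym cone_le_refl)
  moreover have "order_emb L ?H f"
    using le partial_order_cone_order[of "f ` carrier L"] weak_partial_order_axioms
    by (auto simp: order_emb_def cone_order_def partial_order_def)
  ultimately have iso: "order_iso L ?H f"
    by (simp add: order_iso_def cone_order_def bij_betw_def)
  then have "planar_lattice_diagram ?H"
    using planar_lattice_diagram_cone_order lattice_order_iso[OF assms(2) partial_order_cone_order]
      assms(3) by blast
  then show ?thesis using iso unfolding planar_def by blast
qed

theorem theorem2: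
  fixes L :: "('a, 'm) gorder_scheme"
  assumes "lattice L" and "finite (carrier L)"
  shows "(planar L \<longleftrightarrow> (\<exists>lam. complementary_order L lam))
    \<and> ((\<exists>lam. complementary_order L lam) \<longleftrightarrow> order_dim_le_2 L)
    \<and> (order_dim_le_2 L \<longleftrightarrow> embeds_into_two_chains TYPE('c::infinite) TYPE('d::infinite) L)"
proof -
  have po: "partial_order L"
    using assms(1) by (simp add: lattice_def upper_semilattice_def)
  show ?thesis
    using planar_imp_complementary_order[OF _ po] complementary_order_imp_dim[OF _ po]
      dim_imp_complementary_order[OF _ po] dim_imp_planar[OF _ assms]
      dim_imp_embeds[OF _ po assms(2)] embeds_imp_dim[OF _ po]
    by blast
qed

end
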